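(* Let $\Sigma=\{0,1\}$. For every $X\in\Sigma^\infty$, $$\dim_{\mathrm{FS}}(X)=\dim_{\mathrm{FS}}^{\mathrm{multi-bet}}(X),$$ i.e. the finite state dimension of $X$ equals its multi-bet finite state dimension.
   Context: $\Sigma=\{0,1\}$; $X\restriction n$ is the string of the first $n$ symbols of $X\in\Sigma^\infty$; $\lambda$ is the empty string. For an integer $k\ge1$, a $k$-bet finite-state gambler is a tuple $G=(Q,\delta,\vec\beta,q_0,c_0)$ with $Q$ a nonempty finite set of states, $\delta:Q\times\{0,1\}\to Q$ the transition function, $\vec\beta=(\beta_1,\dots,\beta_k):Q\to(\mathbb{Q}\cap[0,1])^k$ the betting function, $q_0\in Q$ the initial state, and $c_0$ a nonnegative rational (initial capital). For $w\in\{0,1\}^*$ write $\beta_i(w)$ for $\beta_i$ evaluated at the state reached from $q_0$ after reading $w$. For $s\in[0,\infty)$ the induced $s$-product-gale ($k$-bet finite state $s$-gale) $d_G^s:\{0,1\}^*\to[0,\infty)$ is given by $d_G^s(\lambda)=c_0$ and, for $b\in\{0,1\}$, $d_G^s(wb)=d_G^s(w)\prod_{i=1}^k 2^s\left[(1-b)(1-\beta_i(w))+b\,\beta_i(w)\right]$. It succeeds on $X$ if $\limsup_{n\to\infty}d_G^s(X\restriction n)=\infty$. A finite-state gambler is a $1$-bet finite-state gambler, and the finite state $s$-gale it induces is $d_G^s$ with $k=1$. $\mathcal{G}_{FS}(X)$ is the set of $s\in[0,1]$ for which some finite-state gambler $G$ has $d_G^s$ succeeding on $X$; $\mathcal{G}_{FS}^{\mathrm{multi-bet}}(X)$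 is the set of $s\in[0,1]$ for which there exist $k\ge1$ and a $k$-bet finite-state gambler $G$ such that $d_G^s$ succeeds on $X$. Then $\dim_{\mathrm{FS}}(X)=\inf\mathcal{G}_{FS}(X)$ and $\dim_{\mathrm{FS}}^{\mathrm{multi-bet}}(X)=\inf\mathcal{G}_{FS}^{\mathrm{multi-bet}}(X)$, infima being taken in $[0,1]$ (so $\inf\emptyset=1$). *)

theory Defs
  imports Complex_Main "HOL-Library.Extended_Real"
begin

text \<open>The alphabet \<open>{0,1}\<close> is \<^typ>\<open>bool\<close>, with \<^const>\<open>False\<close> for \<open>0\<close> and \<^const>\<open>True\<close> for \<open>1\<close>;
  \<^const>\<open>of_bool\<close> turns a symbol into the corresponding number.\<close>

definition prefix_of :: "(nat \<Rightarrow> bool) \<Rightarrow> nat \<Rightarrow> bool list"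
  where "prefix_of X n = map X [0..<n]"

record 'q gambler =
  states :: "'q set"
  trans :: "'q \<Rightarrow> bool \<Rightarrow> 'q"
  bet :: "nat \<Rightarrow> 'q \<Rightarrow> rat"
  start :: 'q
  capital :: rat

text \<open>The components of the betting function are \<open>bet G 1, \<dots>, bet G k\<close>. Values of \<open>trans\<close> and
  \<open>bet\<close> at arguments outside \<open>states\<close>, or at other indices, are irrelevant.\<close>

definition k_bet_gambler :: "nat \<Rightarrow> 'q gambler \<Rightarrow> bool"
  where "k_bet_gambler k G \<longleftrightarrow>
    k \<ge> 1 \<and>
    finite (states G) \<and> states G \<noteq> {} \<and>
    (\<forall>q\<in>states G. \<forall>b. trans G q b \<in> states G) \<and>
    (\<forall>q\<in>states G. \<forall>i\<in>{1..k}. 0 \<le> bet G i q \<and> bet G i q \<le> 1) \<and>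
    start G \<in> states G \<and>
    0 \<le> capital G"

definition state_after :: "'q gambler \<Rightarrow> bool list \<Rightarrow> 'q"
  where "state_after G w = foldl (trans G) (start G) w"

definition bet_after :: "'q gambler \<Rightarrow> nat \<Rightarrow> bool list \<Rightarrow> real"
  where "bet_after G i w = of_rat (bet G i (state_after G w))"

function product_gale :: "nat \<Rightarrow> real \<Rightarrow> 'q gambler \<Rightarrow> bool list \<Rightarrow> real"
  where
    "product_gale k s G [] = of_rat (capital G)"
  | "product_gale k s G (w @ [b]) = product_gale k s G w *
      (\<Prod>i=1..k. 2 powr s *
        ((1 - of_bool b) * (1 - bet_after G i w) + of_bool b * bet_after G i w))"
  by (auto, metis rev_exhaust)
termination
  by (relation "measure (\<lambda>(k, s, G, w). length w)") auto

definition succeeds_on :: "(bool list \<Rightarrow> real) \<Rightarrow> (nat \<Rightarrow> bool) \<Rightarrow> bool"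
  where "succeeds_on d X \<longleftrightarrow> limsup (\<lambda>n. ereal (d (prefix_of X n))) = \<infinity>"

text \<open>HOL cannot quantify existentially over the type of states, so the gamblers below have finite
  sets of natural numbers as state sets. The next lemma shows that this excludes no gale.\<close>

lemma k_bet_gambler_nat_states:
  fixes G :: "'q gambler"
  assumes "k_bet_gambler k G"
  shows "\<exists>H :: nat gambler. k_bet_gambler k H \<and>
    (\<forall>s w. product_gale k s H w = product_gale k s G w)"
proof -
  obtain f :: "'q \<Rightarrow> nat" where f: "inj_on f (states G)"
    using assms finite_imp_inj_to_nat_seg[of "states G"] unfolding k_bet_gambler_def by blast
  let ?g = "inv_into (states G) f"
  define H :: "nat gambler" where
    "H = \<lparr>states = f ` states G, trans = (\<lambda>n b. f (trans G (?g n) b)),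
          bet = (\<lambda>i n. bet G i (?g n)), start = f (start G), capital = capital G\<rparr>"
  have gf: "?g (f q) = q" if "q \<in> states G" for q
    using f that by simp
  have wf: "k_bet_gambler k H"
    using assms gf unfolding k_bet_gambler_def H_def by auto
  have st: "state_after G w \<in> states G \<and> state_after H w = f (state_after G w)" for w
    by (induction w rule: rev_induct)
      (use assms gf in \<open>auto simp: state_after_def k_bet_gambler_def H_def\<close>)
  have bt: "bet_after H i w = bet_after G i w" for i w
    using st[of w] gf by (simp add: bet_after_def) (simp add: H_def gf)
  have "product_gale k s H w = product_gale k s G w" for s w
    by (induction w rule: rev_induct) (simp_all add: bt, simp add: H_def)
  with wf show ?thesis by blast
qed

definition G_FS :: "(nat \<Rightarrow> bool) \<Rightarrow> real set"
  where "G_FS X = {s \<in> {0..1}.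
    \<exists>G :: nat gambler. k_bet_gambler 1 G \<and> succeeds_on (product_gale 1 s G) X}"

definition G_FS_multi_bet :: "(nat \<Rightarrow> bool) \<Rightarrow> real set"
  where "G_FS_multi_bet X = {s \<in> {0..1}.
    \<exists>k\<ge>1. \<exists>G :: nat gambler. k_bet_gambler k G \<and> succeeds_on (product_gale k s G) X}"

text \<open>Infimum of a subset of \<open>[0,1]\<close>, taken in \<open>[0,1]\<close>.\<close>

definition inf_unit :: "real set \<Rightarrow> real"
  where "inf_unit S = (if S = {} then 1 else Inf S)"

definition dim_FS :: "(nat \<Rightarrow> bool) \<Rightarrow> real"
  where "dim_FS X = inf_unit (G_FS X)"

definition dim_FS_multi_bet :: "(nat \<Rightarrow> bool) \<Rightarrow> real"
  where "dim_FS_multi_bet X = inf_unit (G_FS_multi_bet X)"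

end

theory Submission
  imports Defs
begin

text \<open>A \<open>k\<close>-bet \<open>s\<close>-gale is, up to its initial capital, the product of the \<open>k\<close> finite state
  \<open>s\<close>-gales that play its bets separately. If each of these were eventually bounded along \<open>X\<close>, so
  would be their product; hence one of the factors succeeds whenever the product does, for the
  same \<open>s\<close>.\<close>

lemma not_succeeds_on_iff:
  "\<not> succeeds_on d X \<longleftrightarrow> (\<exists>C. \<forall>\<^sub>F n in sequentially. d (prefix_of X n) \<le> C)"
proof
  assume "\<not> succeeds_on d X"
  then have "limsup (\<lambda>n. ereal (d (prefix_of X n))) < \<infinity>"
    by (simp add: succeeds_on_def less_top)
  \<comment> \<open>A limsup below infinity leaves room for a real strictly above it; the strict gap
    is what forces all late terms below that real.\<close>
  then obtain C where "limsup (\<lambda>n. ereal (d (prefix_of X n))) < ereal C"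
    using ereal_dense2 by blast
  then have "\<forall>\<^sub>F n in sequentially. ereal (d (prefix_of X n)) < ereal C"
    by (rule Limsup_lessD)
  then have "\<forall>\<^sub>F n in sequentially. d (prefix_of X n) \<le> C"
    by (rule eventually_mono) simp
  then show "\<exists>C. \<forall>\<^sub>F n in sequentially. d (prefix_of X n) \<le> C"
    by blast
next
  assume "\<exists>C. \<forall>\<^sub>F n in sequentially. d (prefix_of X n) \<le> C"
  then obtain C where "\<forall>\<^sub>F n in sequentially. ereal (d (prefix_of X n)) \<le> ereal C"
    by auto
  then have "limsup (\<lambda>n. ereal (d (prefix_of X n))) \<le> ereal C"
    by (rule Limsup_bounded)
  then show "\<not> succeeds_on d X"
    by (auto simp: succeeds_on_def)
qed

text \<open>Keeping states and transitions makes every copy run in step with \<open>G\<close>. The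
  bet ignores its index, so index 1 reads the \<open>i\<close>-th bet. Capital 1 lets the capital of
  \<open>G\<close> enter the factorization below once instead of once per factor.\<close>

definition single_bet :: "nat \<Rightarrow> 'q gambler \<Rightarrow> 'q gambler"
  where "single_bet i G = G\<lparr>bet := \<lambda>_. bet G i, capital := 1\<rparr>"

lemma state_after_single_bet [simp]: "state_after (single_bet i G) w = state_after G w"
  by (simp add: state_after_def single_bet_def)

lemma bet_after_single_bet [simp]: "bet_after (single_bet i G) j w = bet_after G i w"
  by (simp add: bet_after_def) (simp add: single_bet_def)

lemma k_bet_gambler_single_bet:
  assumes "k_bet_gambler k G" and "i \<in> {1..k}"
  shows "k_bet_gambler 1 (single_bet i G)"
  using assms by (auto simp: k_bet_gambler_def single_bet_def)

lemma state_after_in_states: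
  assumes "k_bet_gambler k G"
  shows "state_after G w \<in> states G"
  by (induction w rule: rev_induct) (use assms in \<open>auto simp: state_after_def k_bet_gambler_def\<close>)

lemma bet_after_bounds:
  assumes "k_bet_gambler k G" and "i \<in> {1..k}"
  shows "0 \<le> bet_after G i w" and "bet_after G i w \<le> 1"
  using assms state_after_in_states[OF assms(1), of w]
  by (auto simp: bet_after_def k_bet_gambler_def)

text \<open>Upper bounds on factors can be multiplied safely once the factors are known to be
  nonnegative. The sign is preserved along \<open>w\<close> because every bet at a reachable state
  lies in [0,1].\<close>

lemma product_gale_nonneg:
  assumes "k_bet_gambler k G"
  shows "0 \<le> product_gale k s G w"
proof (induction w rule: rev_induct)
  case Nil
  then show ?case
    using assms by (simp add: k_bet_gambler_def)
next
  case (snoc b w)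
  then show ?case
    using bet_after_bounds[OF assms]
    by (auto intro!: mult_nonneg_nonneg prod_nonneg add_nonneg_nonneg)
qed

text \<open>After \<open>w\<close> all the single-bet gamblers are in the state of \<open>G\<close>,
  so one more symbol multiplies the \<open>i\<close>-th gale by exactly the \<open>i\<close>-th
  factor of the product rule; \<open>prod.distrib\<close> regroups these factors.\<close>

lemma product_gale_factorization:
  "product_gale k s G w = of_rat (capital G) * (\<Prod>i=1..k. product_gale 1 s (single_bet i G) w)"
proof (induction w rule: rev_induct)
  case Nil
  then show ?case
    by (simp add: single_bet_def)
next
  case (snoc b w)
  then show ?case
    by (simp add: prod.distrib)
qed

lemma succeeds_on_single_bet:
  assumes G: "k_bet_gambler k G" and succ: "succeeds_on (product_gale k s G) X"
  shows "\<exists>i\<in>{1..k}. succeeds_on (product_gale 1 s (single_bet i G)) X"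
proof (rule ccontr)
  assume "\<not> ?thesis"
  then have "\<forall>i\<in>{1..k}. \<exists>C. \<forall>\<^sub>F n in sequentially.
      product_gale 1 s (single_bet i G) (prefix_of X n) \<le> C"
    by (simp add: not_succeeds_on_iff)
  then obtain C where "\<forall>i\<in>{1..k}. \<forall>\<^sub>F n in sequentially.
      product_gale 1 s (single_bet i G) (prefix_of X n) \<le> C i"
    by metis
  \<comment> \<open>There are only finitely many bounds, so beyond a common index all of them hold
    at once.\<close>
  then have "\<forall>\<^sub>F n in sequentially. \<forall>i\<in>{1..k}.
      product_gale 1 s (single_bet i G) (prefix_of X n) \<le> C i"
    by (intro eventually_ball_finite) auto
  then have "\<forall>\<^sub>F n in sequentially.
      product_gale k s G (prefix_of X n) \<le> of_rat (capital G) * (\<Prod>i=1..k. C i)"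
  proof (rule eventually_mono)
    fix n
    assume "\<forall>i\<in>{1..k}. product_gale 1 s (single_bet i G) (prefix_of X n) \<le> C i"
    then have "(\<Prod>i=1..k. product_gale 1 s (single_bet i G) (prefix_of X n)) \<le> (\<Prod>i=1..k. C i)"
      using product_gale_nonneg[OF k_bet_gambler_single_bet[OF G]] by (intro prod_mono) blast
    then show "product_gale k s G (prefix_of X n) \<le> of_rat (capital G) * (\<Prod>i=1..k. C i)"
      \<comment> \<open>The equation is fixed at \<open>k\<close> because the one-bet gales on its
        right are again instances of the general form, and rewriting would not end.\<close>
      unfolding product_gale_factorization[of k]
      using G by (intro mult_left_mono) (auto simp: k_bet_gambler_def)
  qed
  then show False
    using succ not_succeeds_on_iff by blast
qed

text \<open>Passing to a single bet leaves \<open>s\<close> unchanged, so the sets themselves agree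
  and not only their infima; the converse inclusion is the case of one bet.\<close>

lemma G_FS_multi_bet_eq: "G_FS_multi_bet X = G_FS X"
proof
  show "G_FS_multi_bet X \<subseteq> G_FS X"
    unfolding G_FS_multi_bet_def G_FS_def
    using succeeds_on_single_bet k_bet_gambler_single_bet by blast
  show "G_FS X \<subseteq> G_FS_multi_bet X"
    unfolding G_FS_multi_bet_def G_FS_def by blast
qed

theorem theorem5:
  fixes X :: "nat \<Rightarrow> bool"
  shows "dim_FS X = dim_FS_multi_bet X"
  by (simp add: dim_FS_def dim_FS_multi_bet_def G_FS_multi_bet_eq)

end
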